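(* Let $n=|I|\geq 3$, let $m_+\in B$ and let $m_0=m_+>m_1>m_2>\cdots$ be the countable set $D_{m_+}$ with a total ordering compatible with the partial ordering $\leq$. Then the $t$-algorithm never fails: for every $R\geq0$ it is well defined to step $R$, i.e. there exist $s(m_r)(t)\in\mathbb{Z}[t^{\pm1}]$ and $s_J(m_r)(t)\in\mathbb{Z}[t^{\pm1}]$ ($0\le r\le R$, $J\subsetneq I$) satisfying all the formulas defining the $t$-algorithm for $r\le R$: $$s(m_0)(t)=1,\qquad s_J(m_0)(t)=0,$$ and for $r\ge1$, $J\subsetneq I$: $$s_J(m_r)(t)=\sum_{r'<r}\bigl(s(m_{r'})(t)-s_J(m_{r'})(t)\bigr)[F_{J,t}(m_{r'})]_{m_r},$$ $$s(m_r)(t)=s_J(m_r)(t)\ \text{ if } m_r\notin B_J,\qquad s(m_r)(t)=0\ \text{ if } m_r\in B.$$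
   Context: Cartan data. $I=\{1,\dots,n\}$, $C=(C_{i,j})$ a Cartan matrix of finite type, $r_i\in\mathbb{N}^*$ with $(r_iC_{i,j})$ symmetric, coprime on each indecomposable component. $z$ is an indeterminate, $[l]_z=\frac{z^l-z^{-l}}{z-z^{-1}}$, $C(z)_{i,i}=z^{r_i}+z^{-r_i}$, $C(z)_{i,j}=[C_{i,j}]_z$ ($i\neq j$), $\tilde C(z)=C(z)^{-1}$; $(\tilde C_{i,j})_r\in\mathbb{Z}$ is the coefficient of $z^r$ in the expansion of $\tilde C_{i,j}(z)$ in $\mathbb{Z}((z^{-1}))$. Monomials. $\mathcal{Y}=\mathbb{Z}[Y_{i,l}^{\pm1}]_{i\in I,l\in\mathbb{Z}}$ (commutative), $A$ is its set of Laurent monomials $m=\prod Y_{i,l}^{u_{i,l}(m)}$, and $$A_{i,l}=Y_{i,l-r_i}Y_{i,l+r_i}\prod_{C_{j,i}=-1}Y_{j,l}^{-1}\prod_{C_{j,i}=-2}Y_{j,l+1}^{-1}Y_{j,l-1}^{-1}\prod_{C_{j,i}=-3}Y_{j,l+2}^{-1}Y_{j,l}^{-1}Y_{j,l-2}^{-1}.$$ $m\le m'$ means that $m(m')^{-1}$ is a (possibly empty) product of elements $A_{i,l}^{-1}$. $B_i=\{m\in A:u_{i,l}(m)\ge0\ \forall l\}$, $B_J=\bigcap_{i\in J}B_i$ ($J$-dominant monomials), $B=B_I$ (dominant monomials). The algebra $\mathcal{Y}_t$. It is the free $\mathbb{Z}[t^{\pm1}]$-module with basis $\{:\!m\!:\,\mid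 m\in A\}$ and $\mathbb{Z}[t^{\pm1}]$-bilinear associative product $:\!m_1\!:\,:\!m_2\!:\,=t^{\mathcal{N}(m_1,m_2)}:\!m_1m_2\!:$, where $\mathcal{N}:A\times A\to\mathbb{Z}$ is the bicharacter with $\mathcal{N}(Y_{i,l},Y_{j,k})=(\tilde C_{j,i})_{r_j+l-k}-(\tilde C_{j,i})_{-r_j+l-k}$. Put $\tilde Y_{i,l}=:\!Y_{i,l}\!:$, $\tilde A_{i,l}=:\!A_{i,l}\!:$ (invertible, $\tilde A_{i,l}^{-1}=:\!A_{i,l}^{-1}\!:$). We identify $m$ with $:\!m\!:$; the monomials of an element are the $m$ with nonzero coefficient. $\overset{\rightarrow}{\prod}_{l}$ is the product ordered by increasing $l$. Completions. For $m\in B_i$ put $E_{i,t}(m)=\overset{\rightarrow}{\prod}_{l\in\mathbb{Z}}\bigl((\tilde Y_{i,l}(1+t\tilde A_{i,l+r_i}^{-1}))^{u_{i,l}(m)}\prod_{j\ne i}\tilde Y_{j,l}^{u_{j,l}(m)}\bigr)$. Let $\mathcal{Y}_t^{A,K}$ be the $\mathbb{Z}[t^{\pm1}]$-span of the $:\!a\!:$ with $a$ a product of $K$ elements $A_{j,l}^{-1}$, $\mathcal{Y}_t^{A,\infty}=\prod_{K\ge0}\mathcal{Y}_t^{A,K}$, and $\mathcal{Y}_t^\infty=\sum_{M\in A}:\!M\!:\mathcal{Y}_t^{A,\infty}\subset\prod_{m\in A}\mathbb{Z}[t^{\pm1}]:\!m\!:$ (finite sums over $M$). $\mathfrak{K}_{i,t}^\infty\subset\mathcal{Y}_t^\infty$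 is the set of finite sums, over $M\in A$, of elements $\sum_{K\ge0}\sum_a\lambda_a(t)E_{i,t}(Ma)$, where for each $K$ the inner sum is over finitely many products $a$ of $K$ elements $A_{j,l}^{-1}$ with $Ma\in B_i$, $\lambda_a(t)\in\mathbb{Z}[t^{\pm1}]$. $\mathfrak{K}_{J,t}^\infty=\bigcap_{i\in J}\mathfrak{K}_{i,t}^\infty$. The sets $D_m$. Let $\mathfrak{K}_i\subset\mathcal{Y}$ be the subring generated by the $Y_{i,l}(1+A_{i,l+r_i}^{-1})$ and $Y_{j,l}^{\pm1}$ ($j\neq i$, $l\in\mathbb{Z}$) and $\mathfrak{K}_J=\bigcap_{i\in J}\mathfrak{K}_i$. For $j\in J\subset I$ it is known (Frenkel–Reshetikhin, Frenkel–Mukhin) that there is a unique $E_J(Y_{j,l})\in\mathfrak{K}_J$ whose only $J$-dominant monomial is $Y_{j,l}$, with coefficient 1. For $m\in B_J$ put $E_J(m)=\prod_{i\notin J,l}Y_{i,l}^{u_{i,l}(m)}\prod_{j\in J,l}E_J(Y_{j,l})^{u_{j,l}(m)}$. For $m\in A$, $D_m$ is the set of $m'\in A$ for which there is a finite sequence $(m_0=m,m_1,\dots,m_R=m')$ such that for all $1\le r\le R$ there are $r'<r$ and $J\subset I$ with $m_{r'}\in B_J$ and, for all $r'<r''\le r$, $m_{r''}$ is a monomial of $E_J(m_{r'})$ and $m_{r''}m_{r''-1}^{-1}\in\{A_{j,l}^{-1}:l\in\mathbb{Z},j\in J\}$. $\tilde D_m\subset\mathcal{Y}_t^\infty$ is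 the submodule of all sums $\sum_{m'\in D_m}\lambda_{m'}(t):\!m'\!:$. The $F_{J,t}(m)$. $J$ ranges over nonempty proper subsets of $I$. It is assumed known that for each such $J$ and each $m\in B_J$ there is a unique $F_{J,t}(m)\in\mathfrak{K}_{J,t}^\infty\cap\tilde D_m$ whose unique $J$-dominant monomial is $m$, with coefficient 1, and that the elements of $\mathfrak{K}_{J,t}^\infty\cap\tilde D_{m_+}$ are exactly the infinite sums $\sum_{m\in D_{m_+}\cap B_J}\lambda_m(t)F_{J,t}(m)$, $\lambda_m(t)\in\mathbb{Z}[t^{\pm1}]$. For $m\in A\setminus B_J$ put $F_{J,t}(m)=0$. $[F_{J,t}(m_{r'})]_{m_r}\in\mathbb{Z}[t^{\pm1}]$ is the coefficient of $m_r$ in $F_{J,t}(m_{r'})$. *)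

theory Defs
  imports
    "HOL-Analysis.Analysis"
    "HOL-Library.Poly_Mapping"
    "HOL-Library.Multiset"
    "HOL-Library.Extended_Nat"
    "HOL-Combinatorics.Permutations"
    "HOL-Computational_Algebra.Formal_Laurent_Series"
begin

section \<open>Cartan data\<close>

text \<open>
  The index set \<open>I\<close> is a finite linearly ordered type \<open>'i\<close>. The order is only used to write
  down products of commuting elements of a non-commutative algebra.
\<close>

definition principal_minor :: "('i::finite \<Rightarrow> 'i \<Rightarrow> int) \<Rightarrow> 'i set \<Rightarrow> int" where
  "principal_minor C S = (\<Sum>p | p permutes S. sign p * (\<Prod>i\<in>S. C i (p i)))"

definition cartan_matrix_finite_type :: "('i::finite \<Rightarrow> 'i \<Rightarrow> int) \<Rightarrow> bool" where
  "cartan_matrix_finite_type C \<longleftrightarrow>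
     (\<forall>i. C i i = 2) \<and>
     (\<forall>i j. i \<noteq> j \<longrightarrow> C i j \<le> 0) \<and>
     (\<forall>i j. C i j = 0 \<longleftrightarrow> C j i = 0) \<and>
     (\<forall>S. principal_minor C S > 0)"

definition indecomposable_component :: "('i \<Rightarrow> 'i \<Rightarrow> int) \<Rightarrow> 'i \<Rightarrow> 'i set" where
  "indecomposable_component C i = {j. (i, j) \<in> {(a, b). C a b \<noteq> 0}\<^sup>*}"

definition cartan_data :: "('i::finite \<Rightarrow> 'i \<Rightarrow> int) \<Rightarrow> ('i \<Rightarrow> nat) \<Rightarrow> bool" where
  "cartan_data C r \<longleftrightarrow>
     cartan_matrix_finite_type C \<and>
     (\<forall>i. r i > 0) \<and>
     (\<forall>i j. int (r i) * C i j = int (r j) * C j i) \<and>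
     (\<forall>i. Gcd (r ` indecomposable_component C i) = 1)"

text \<open>
  Laurent series in \<open>z\<^sup>-\<^sup>1\<close> over the rationals: the series variable \<open>fls_X\<close> stands for
  \<open>z\<^sup>-\<^sup>1\<close>, so the coefficient of \<open>z\<^sup>k\<close> is the one with index \<open>-k\<close>. Expansion embeds the
  rational functions in \<open>z\<close> into this field, so inverting \<open>C(z)\<close> here gives the expansion of the
  inverse.
\<close>

definition z_var :: "rat fls" where
  "z_var = inverse fls_X"

definition quantum_int :: "int \<Rightarrow> rat fls" where
  "quantum_int l = (z_var powi l - z_var powi (- l)) / (z_var - inverse z_var)"

definition quantum_cartan :: "('i::finite \<Rightarrow> 'i \<Rightarrow> int) \<Rightarrow> ('i \<Rightarrow> nat) \<Rightarrow> rat fls ^ 'i ^ 'i" where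
  "quantum_cartan C r =
     (\<chi> i j. if i = j then z_var powi int (r i) + z_var powi (- int (r i))
             else quantum_int (C i j))"

text \<open>The coefficients are integers for Cartan data, so the floor only changes the type.\<close>

definition ctilde :: "('i::finite \<Rightarrow> 'i \<Rightarrow> int) \<Rightarrow> ('i \<Rightarrow> nat) \<Rightarrow> 'i \<Rightarrow> 'i \<Rightarrow> int \<Rightarrow> int" where
  "ctilde C r i j k = \<lfloor>fls_nth (matrix_inv (quantum_cartan C r) $ i $ j) (- k)\<rfloor>"


section \<open>Monomials\<close>

text \<open>
  The multiplicative group \<open>A\<close> of Laurent monomials is written additively: a monomial is its
  exponent function \<open>(i, l) \<mapsto> u\<^sub>i\<^sub>,\<^sub>l(m)\<close>.
\<close>

type_synonym 'i monom = "('i \<times> int) \<Rightarrow>\<^sub>0 int"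

type_synonym laurent = "int \<Rightarrow>\<^sub>0 int"  \<comment> \<open>Laurent polynomials in \<open>t\<close> with integer coefficients\<close>

definition t_pow :: "int \<Rightarrow> laurent" where
  "t_pow k = Poly_Mapping.single k 1"

definition Yv :: "'i \<Rightarrow> int \<Rightarrow> 'i monom" where
  "Yv i l = Poly_Mapping.single (i, l) 1"

definition Av :: "('i::finite \<Rightarrow> 'i \<Rightarrow> int) \<Rightarrow> ('i \<Rightarrow> nat) \<Rightarrow> 'i \<Rightarrow> int \<Rightarrow> 'i monom" where
  "Av C r i l =
     Yv i (l - int (r i)) + Yv i (l + int (r i))
     - (\<Sum>j | C j i = -1. Yv j l)
     - (\<Sum>j | C j i = -2. Yv j (l + 1) + Yv j (l - 1))
     - (\<Sum>j | C j i = -3. Yv j (l + 2) + Yv j l + Yv j (l - 2))"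

definition A_prods :: "('i::finite \<Rightarrow> 'i \<Rightarrow> int) \<Rightarrow> ('i \<Rightarrow> nat) \<Rightarrow> nat \<Rightarrow> 'i monom set" where
  "A_prods C r K = {- (\<Sum>(j, l)\<in>#P. Av C r j l) | P. size P = K}"

definition mon_le :: "('i::finite \<Rightarrow> 'i \<Rightarrow> int) \<Rightarrow> ('i \<Rightarrow> nat) \<Rightarrow> 'i monom \<Rightarrow> 'i monom \<Rightarrow> bool" where
  "mon_le C r m m' \<longleftrightarrow> (\<exists>K. m - m' \<in> A_prods C r K)"

definition dominant :: "'i set \<Rightarrow> 'i monom set" where
  "dominant J = {m. \<forall>i\<in>J. \<forall>l. Poly_Mapping.lookup m (i, l) \<ge> 0}"


section \<open>The deformed algebra\<close>

definition N_gen :: "('i::finite \<Rightarrow> 'i \<Rightarrow> int) \<Rightarrow> ('i \<Rightarrow> nat) \<Rightarrow> 'i \<times> int \<Rightarrow> 'i \<times> int \<Rightarrow> int" where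
  "N_gen C r = (\<lambda>(i, l) (j, k).
     ctilde C r j i (int (r j) + l - k) - ctilde C r j i (- int (r j) + l - k))"

definition N_char :: "('i::finite \<Rightarrow> 'i \<Rightarrow> int) \<Rightarrow> ('i \<Rightarrow> nat) \<Rightarrow> 'i monom \<Rightarrow> 'i monom \<Rightarrow> int" where
  "N_char C r m1 m2 =
     (\<Sum>p\<in>Poly_Mapping.keys m1. \<Sum>q\<in>Poly_Mapping.keys m2.
        Poly_Mapping.lookup m1 p * Poly_Mapping.lookup m2 q * N_gen C r p q)"

text \<open>
  Elements of \<open>\<Y>\<^sub>t\<close> are given by their coefficients in the basis \<open>:m:\<close>. The library product on
  this type is the untwisted commutative one; the product of \<open>\<Y>\<^sub>t\<close> is \<open>t_mult\<close>, for which the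
  library's \<open>1\<close> is the unit.
\<close>

type_synonym 'i Yt = "'i monom \<Rightarrow>\<^sub>0 laurent"

definition t_mult :: "('i::finite \<Rightarrow> 'i \<Rightarrow> int) \<Rightarrow> ('i \<Rightarrow> nat) \<Rightarrow> 'i Yt \<Rightarrow> 'i Yt \<Rightarrow> 'i Yt" where
  "t_mult C r f g =
     (\<Sum>m1\<in>Poly_Mapping.keys f. \<Sum>m2\<in>Poly_Mapping.keys g.
        Poly_Mapping.single (m1 + m2)
          (t_pow (N_char C r m1 m2) * Poly_Mapping.lookup f m1 * Poly_Mapping.lookup g m2))"

definition t_prod_list :: "('i::finite \<Rightarrow> 'i \<Rightarrow> int) \<Rightarrow> ('i \<Rightarrow> nat) \<Rightarrow> 'i Yt list \<Rightarrow> 'i Yt" where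
  "t_prod_list C r xs = foldr (t_mult C r) xs 1"

definition t_inv :: "('i::finite \<Rightarrow> 'i \<Rightarrow> int) \<Rightarrow> ('i \<Rightarrow> nat) \<Rightarrow> 'i Yt \<Rightarrow> 'i Yt" where
  "t_inv C r x = (THE y. t_mult C r x y = 1 \<and> t_mult C r y x = 1)"

definition t_powi :: "('i::finite \<Rightarrow> 'i \<Rightarrow> int) \<Rightarrow> ('i \<Rightarrow> nat) \<Rightarrow> 'i Yt \<Rightarrow> int \<Rightarrow> 'i Yt" where
  "t_powi C r x u =
     (if u \<ge> 0 then t_prod_list C r (replicate (nat u) x)
      else t_prod_list C r (replicate (nat (- u)) (t_inv C r x)))"

text \<open>The basis element \<open>:m:\<close>.\<close>

definition nord :: "'i monom \<Rightarrow> 'i Yt" where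
  "nord m = Poly_Mapping.single m 1"

text \<open>
  In \<open>E_t\<close>, all factors with \<open>l\<close> outside the finite set below are \<open>1\<close>. The elements
  \<open>:Y\<^sub>j\<^sub>,\<^sub>l:\<close> with the same \<open>l\<close> commute. The scalar \<open>t\<close> of \<open>t :A\<^sup>-\<^sup>1:\<close> is put in as
  the coefficient; \<open>:A\<^sup>-\<^sup>1:\<close> is the inverse of \<open>:A:\<close>.
\<close>

definition E_t :: "('i::{finite,linorder} \<Rightarrow> 'i \<Rightarrow> int) \<Rightarrow> ('i \<Rightarrow> nat) \<Rightarrow> 'i \<Rightarrow> 'i monom \<Rightarrow> 'i Yt" where
  "E_t C r i m =
     t_prod_list C r
       (map (\<lambda>l.
           t_mult C r
             (t_powi C r
                (t_mult C r (nord (Yv i l))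
                   (1 + Poly_Mapping.single (- Av C r i (l + int (r i))) (t_pow 1)))
                (Poly_Mapping.lookup m (i, l)))
             (t_prod_list C r
                (map (\<lambda>j. t_powi C r (nord (Yv j l)) (Poly_Mapping.lookup m (j, l)))
                   (sorted_list_of_set (UNIV - {i})))))
         (sorted_list_of_set (snd ` Poly_Mapping.keys m)))"


section \<open>Completions\<close>

text \<open>
  Elements of \<open>\<Prod>\<^sub>m \<int>[t\<^sup>\<plusminus>\<^sup>1] :m:\<close> are functions on monomials. The monomials \<open>A\<^sub>j\<^sub>,\<^sub>l\<close> are
  independent, so the sets \<open>A_prods C r K\<close> are pairwise disjoint and the product over \<open>K\<close> of the
  spans \<open>\<Y>\<^sub>t\<^sup>A\<^sup>,\<^sup>K\<close> consists of the following functions. The same functions are the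
  coefficient families \<open>\<lambda>\<^sub>a\<close> that are finite for each \<open>K\<close>.
\<close>

definition YtA_inf :: "('i::finite \<Rightarrow> 'i \<Rightarrow> int) \<Rightarrow> ('i \<Rightarrow> nat) \<Rightarrow> ('i monom \<Rightarrow> laurent) set" where
  "YtA_inf C r =
     {f. (\<forall>a. f a \<noteq> 0 \<longrightarrow> (\<exists>K. a \<in> A_prods C r K)) \<and>
         (\<forall>K. finite {a \<in> A_prods C r K. f a \<noteq> 0})}"

text \<open>
  The completed algebra: the left factor \<open>:M:\<close> shifts by \<open>M\<close> and twists by a power of \<open>t\<close>.
\<close>

definition Yt_inf :: "('i::finite \<Rightarrow> 'i \<Rightarrow> int) \<Rightarrow> ('i \<Rightarrow> nat) \<Rightarrow> ('i monom \<Rightarrow> laurent) set" where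
  "Yt_inf C r =
     {\<lambda>m. \<Sum>M\<in>S. t_pow (N_char C r M (m - M)) * f M (m - M) | S f.
        finite S \<and> (\<forall>M\<in>S. f M \<in> YtA_inf C r)}"

text \<open>
  The sum over \<open>K\<close> and \<open>a\<close> is taken coefficientwise. All monomials of \<open>E_t C r i (M + a)\<close> are
  below \<open>M + a\<close>, so only finitely many \<open>a\<close> contribute to a given monomial \<open>m\<close>.
\<close>

definition E_series ::
  "('i::{finite,linorder} \<Rightarrow> 'i \<Rightarrow> int) \<Rightarrow> ('i \<Rightarrow> nat) \<Rightarrow> 'i \<Rightarrow> 'i monom \<Rightarrow>
     ('i monom \<Rightarrow> laurent) \<Rightarrow> 'i monom \<Rightarrow> laurent" where
  "E_series C r i M lam m =
     (\<Sum>a | lam a \<noteq> 0 \<and> Poly_Mapping.lookup (E_t C r i (M + a)) m \<noteq> 0.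
        lam a * Poly_Mapping.lookup (E_t C r i (M + a)) m)"

definition K_inf_single ::
  "('i::{finite,linorder} \<Rightarrow> 'i \<Rightarrow> int) \<Rightarrow> ('i \<Rightarrow> nat) \<Rightarrow> 'i \<Rightarrow> ('i monom \<Rightarrow> laurent) set" where
  "K_inf_single C r i =
     Yt_inf C r \<inter>
     {\<lambda>m. \<Sum>M\<in>S. E_series C r i M (lam M) m | S lam.
        finite S \<and>
        (\<forall>M\<in>S. lam M \<in> YtA_inf C r \<and> (\<forall>a. lam M a \<noteq> 0 \<longrightarrow> M + a \<in> dominant {i}))}"

definition K_inf ::
  "('i::{finite,linorder} \<Rightarrow> 'i \<Rightarrow> int) \<Rightarrow> ('i \<Rightarrow> nat) \<Rightarrow> 'i set \<Rightarrow> ('i monom \<Rightarrow> laurent) set" where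
  "K_inf C r J = (\<Inter>i\<in>J. K_inf_single C r i)"


section \<open>The sets \<open>D\<^sub>m\<close>\<close>

text \<open>
  The commutative ring \<open>\<Y>\<close> is the group ring of the group of monomials over the integers, with
  the library product.
\<close>

type_synonym 'i Yring = "'i monom \<Rightarrow>\<^sub>0 int"

definition cmon :: "'i monom \<Rightarrow> 'i Yring" where
  "cmon m = Poly_Mapping.single m 1"

inductive_set K_ring_single ::
    "('i::finite \<Rightarrow> 'i \<Rightarrow> int) \<Rightarrow> ('i \<Rightarrow> nat) \<Rightarrow> 'i \<Rightarrow> 'i Yring set"
  for C r i where
  gen_i: "cmon (Yv i l) * (1 + cmon (- Av C r i (l + int (r i)))) \<in> K_ring_single C r i"
| gen_pos: "j \<noteq> i \<Longrightarrow> cmon (Yv j l) \<in> K_ring_single C r i"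
| gen_neg: "j \<noteq> i \<Longrightarrow> cmon (- Yv j l) \<in> K_ring_single C r i"
| one: "1 \<in> K_ring_single C r i"
| diff: "x \<in> K_ring_single C r i \<Longrightarrow> y \<in> K_ring_single C r i \<Longrightarrow> x - y \<in> K_ring_single C r i"
| mult: "x \<in> K_ring_single C r i \<Longrightarrow> y \<in> K_ring_single C r i \<Longrightarrow> x * y \<in> K_ring_single C r i"

definition K_ring :: "('i::finite \<Rightarrow> 'i \<Rightarrow> int) \<Rightarrow> ('i \<Rightarrow> nat) \<Rightarrow> 'i set \<Rightarrow> 'i Yring set" where
  "K_ring C r J = (\<Inter>i\<in>J. K_ring_single C r i)"

definition E_fund :: "('i::finite \<Rightarrow> 'i \<Rightarrow> int) \<Rightarrow> ('i \<Rightarrow> nat) \<Rightarrow> 'i set \<Rightarrow> 'i \<Rightarrow> int \<Rightarrow> 'i Yring" where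
  "E_fund C r J j l =
     (THE x. x \<in> K_ring C r J \<and>
             Poly_Mapping.keys x \<inter> dominant J = {Yv j l} \<and>
             Poly_Mapping.lookup x (Yv j l) = 1)"

text \<open>Only used for \<open>m \<in> dominant J\<close>, where the exponents in the second product are \<open>\<ge> 0\<close>.\<close>

definition E_mon :: "('i::finite \<Rightarrow> 'i \<Rightarrow> int) \<Rightarrow> ('i \<Rightarrow> nat) \<Rightarrow> 'i set \<Rightarrow> 'i monom \<Rightarrow> 'i Yring" where
  "E_mon C r J m =
     (\<Prod>p | p \<in> Poly_Mapping.keys m \<and> fst p \<notin> J.
        cmon (Poly_Mapping.single p (Poly_Mapping.lookup m p))) *
     (\<Prod>(j, l) | (j, l) \<in> Poly_Mapping.keys m \<and> j \<in> J.
        E_fund C r J j l ^ nat (Poly_Mapping.lookup m (j, l)))"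

definition D_set :: "('i::finite \<Rightarrow> 'i \<Rightarrow> int) \<Rightarrow> ('i \<Rightarrow> nat) \<Rightarrow> 'i monom \<Rightarrow> 'i monom set" where
  "D_set C r m =
     {m'. \<exists>(R::nat) (f :: nat \<Rightarrow> 'i monom).
        f 0 = m \<and> f R = m' \<and>
        (\<forall>k. 1 \<le> k \<and> k \<le> R \<longrightarrow>
           (\<exists>k' J. k' < k \<and> f k' \<in> dominant J \<and>
              (\<forall>k''. k' < k'' \<and> k'' \<le> k \<longrightarrow>
                 f k'' \<in> Poly_Mapping.keys (E_mon C r J (f k')) \<and>
                 (\<exists>j\<in>J. \<exists>l. f k'' - f (k'' - 1) = - Av C r j l))))}"

definition D_tilde ::
  "('i::finite \<Rightarrow> 'i \<Rightarrow> int) \<Rightarrow> ('i \<Rightarrow> nat) \<Rightarrow> 'i monom \<Rightarrow> ('i monom \<Rightarrow> laurent) set" where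
  "D_tilde C r m = {x. \<forall>p. x p \<noteq> 0 \<longrightarrow> p \<in> D_set C r m}"


section \<open>The elements \<open>F\<^sub>J\<^sub>,\<^sub>t(m)\<close>\<close>

definition is_F ::
  "('i::{finite,linorder} \<Rightarrow> 'i \<Rightarrow> int) \<Rightarrow> ('i \<Rightarrow> nat) \<Rightarrow> 'i set \<Rightarrow> 'i monom \<Rightarrow>
     ('i monom \<Rightarrow> laurent) \<Rightarrow> bool" where
  "is_F C r J m x \<longleftrightarrow>
     x \<in> K_inf C r J \<inter> D_tilde C r m \<and> {p \<in> dominant J. x p \<noteq> 0} = {m} \<and> x m = 1"

definition F_t ::
  "('i::{finite,linorder} \<Rightarrow> 'i \<Rightarrow> int) \<Rightarrow> ('i \<Rightarrow> nat) \<Rightarrow> 'i set \<Rightarrow> 'i monom \<Rightarrow>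
     'i monom \<Rightarrow> laurent" where
  "F_t C r J m = (if m \<in> dominant J then (THE x. is_F C r J m x) else (\<lambda>_. 0))"

text \<open>
  Infinite sums of elements \<open>\<lambda>\<^sub>m(t) F\<^sub>J\<^sub>,\<^sub>t(m)\<close> over \<open>m\<close> in a set \<open>X\<close>, taken coefficientwise.
  For \<open>X \<subseteq> D_set C r m0\<close> only finitely many \<open>m\<close> contribute to the coefficient of a monomial \<open>p\<close>,
  because they satisfy \<open>p \<le> m \<le> m0\<close>.
\<close>

definition F_sums ::
  "('i::{finite,linorder} \<Rightarrow> 'i \<Rightarrow> int) \<Rightarrow> ('i \<Rightarrow> nat) \<Rightarrow> 'i set \<Rightarrow> 'i monom set \<Rightarrow>
     ('i monom \<Rightarrow> laurent) set" where
  "F_sums C r J X =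
     {\<lambda>p. \<Sum>m | m \<in> X \<and> F_t C r J m p \<noteq> 0. lam m * F_t C r J m p | lam. True}"

end

theory Submission
  imports Defs
begin

text \<open>
  Let \<open>\<chi>\<^sub>J = \<Sum>\<^bsub>r' < r\<^esub> (s(m\<^sub>r\<^sub>') - s\<^sub>J(m\<^sub>r\<^sub>')) F\<^sub>J\<^sub>,\<^sub>t(m\<^sub>r\<^sub>')\<close>, where the algorithm is assumed to be
  well defined before step \<open>r\<close>. Its coefficient at \<open>m\<^sub>r\<^sub>'\<close> is \<open>s(m\<^sub>r\<^sub>')\<close> for \<open>r' < r\<close>, whatever \<open>J\<close> is,
  and \<open>s\<^sub>J(m\<^sub>r)\<close> at \<open>m\<^sub>r\<close>. For \<open>i \<in> J\<close> the element \<open>\<chi>\<^sub>J\<close> is also a combination of the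
  \<open>F\<^sub>i\<^sub>,\<^sub>t(m)\<close>. These are unitriangular, so if \<open>m\<^sub>r\<close> is not \<open>i\<close>-dominant, then the
  coefficients before \<open>m\<^sub>r\<close> determine the one at \<open>m\<^sub>r\<close>, hence \<open>s\<^sub>J(m\<^sub>r) = s\<^sub>i(m\<^sub>r)\<close>.
  If \<open>m\<^sub>r\<close> is neither \<open>i\<close>- nor \<open>j\<close>-dominant, then \<open>J = {i, j}\<close>, which is proper because
  \<open>n \<ge> 3\<close>, gives \<open>s\<^sub>i(m\<^sub>r) = s\<^sub>j(m\<^sub>r)\<close>.
\<close>

section \<open>The order on \<open>D_set\<close> and dominance\<close>

lemma D_set_mon_le:
  assumes "p \<in> D_set C r m"
  shows "mon_le C r p m"
proof -
  obtain R f where f: "f (0::nat) = m" "f R = p"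
    and step: "\<forall>k. 1 \<le> k \<and> k \<le> R \<longrightarrow>
           (\<exists>k' J. k' < k \<and> f k' \<in> dominant J \<and>
              (\<forall>k''. k' < k'' \<and> k'' \<le> k \<longrightarrow>
                 f k'' \<in> Poly_Mapping.keys (E_mon C r J (f k')) \<and>
                 (\<exists>j\<in>J. \<exists>l. f k'' - f (k'' - 1) = - Av C r j l)))"
    using assms unfolding D_set_def mem_Collect_eq by (elim exE conjE) (rule that)
  have "f k - m \<in> A_prods C r k" if "k \<le> R" for k
    using that
  proof (induction k)
    case 0
    then show ?case using f by (simp add: A_prods_def)
  next
    case (Suc k)
    obtain P where P: "f k - m = - (\<Sum>(j, l)\<in>#P. Av C r j l)" "size P = k"
      using Suc by (auto simp: A_prods_def)
    \<comment> \<open>The case \<open>k'' = Suc k\<close> shows that each step of the chain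
      multiplies by a single inverse \<open>Av\<close>.\<close>
    obtain j l where "f (Suc k) - f k = - Av C r j l"
      using step[rule_format, of "Suc k"] Suc.prems by force
    then have "(f (Suc k) - f k) + (f k - m) = - (\<Sum>(j, l)\<in>#add_mset (j, l) P. Av C r j l)"
      using P(1) by simp
    then have "f (Suc k) - m = - (\<Sum>(j, l)\<in>#add_mset (j, l) P. Av C r j l)"
      by (simp only: diff_add_cancel add_diff_eq)
    moreover have "size (add_mset (j, l) P) = Suc k"
      using P(2) by simp
    ultimately show ?case unfolding A_prods_def by blast
  qed
  then show ?thesis using f unfolding mon_le_def by blast
qed

lemma K_inf_antimono: "I \<subseteq> J \<Longrightarrow> K_inf C r J \<subseteq> K_inf C r I"
  unfolding K_inf_def by blast

lemma dominant_antimono: "I \<subseteq> J \<Longrightarrow> dominant J \<subseteq> dominant I"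
  unfolding dominant_def by blast

lemma not_dominantE:
  assumes "p \<notin> dominant J"
  obtains i where "i \<in> J" "p \<notin> dominant {i}"
  using assms unfolding dominant_def by blast

text \<open>Forward substitution: rows outside \<open>X\<close> are zero, and for \<open>a\<close>
  in \<open>X\<close> the equation at column \<open>a\<close>, with diagonal entry 1, forces
  \<open>x a = 0\<close>. Column \<open>n\<close> brings nothing new, since row \<open>n\<close> is
  zero.\<close>

lemma unitriangular_vanish:
  fixes F :: "nat \<Rightarrow> nat \<Rightarrow> 'a::comm_ring_1"
  assumes diag: "\<And>a. a \<in> X \<Longrightarrow> a < n \<Longrightarrow> F a a = 1"
    and outside: "\<And>a b. a \<notin> X \<Longrightarrow> F a b = 0"
    and vanish: "\<And>b. b < n \<Longrightarrow> (\<Sum>a\<le>b. x a * F a b) = 0"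
    and "n \<notin> X"
  shows "(\<Sum>a\<le>n. x a * F a n) = 0"
proof -
  have zero: "x a * F a b = 0" if "a < n" for a b
    using that
  proof (induction a arbitrary: b rule: less_induct)
    case (less a)
    show ?case
    proof (cases "a \<in> X")
      case True
      have "(\<Sum>c\<le>a. x c * F c a) = x a * F a a + (\<Sum>c<a. x c * F c a)"
        by (simp add: lessThan_Suc_atMost[symmetric] add.commute)
      also have "(\<Sum>c<a. x c * F c a) = 0"
        using less by (intro sum.neutral) auto
      finally have "x a = 0"
        using vanish[OF less.prems] diag[OF True less.prems] by simp
      then show ?thesis by simp
    qed (simp add: outside)
  qed
  show ?thesis
    using zero outside[OF \<open>n \<notin> X\<close>]
    by (intro sum.neutral ballI) (metis atMost_iff le_neq_implies_less mult_zero_right)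
qed

section \<open>The algorithm as a total recursion\<close>

text \<open>
  In \<open>t_alg F d\<close>, \<open>F J a b\<close> is the coefficient of \<open>m\<^sub>b\<close> in \<open>F\<^sub>J\<^sub>,\<^sub>t(m\<^sub>a)\<close>, and \<open>d k\<close> is some \<open>i\<close>
  such that \<open>m\<^sub>k\<close> is not \<open>i\<close>-dominant, if there is one.
\<close>

function t_alg :: "('i set \<Rightarrow> nat \<Rightarrow> nat \<Rightarrow> 'a::comm_ring_1) \<Rightarrow> (nat \<Rightarrow> 'i option) \<Rightarrow> nat \<Rightarrow> 'a"
  and t_alg_J :: "('i set \<Rightarrow> nat \<Rightarrow> nat \<Rightarrow> 'a) \<Rightarrow> (nat \<Rightarrow> 'i option) \<Rightarrow> 'i set \<Rightarrow> nat \<Rightarrow> 'a"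
  where
    "t_alg F d k =
       (if k = 0 then 1 else case d k of None \<Rightarrow> 0 | Some i \<Rightarrow> t_alg_J F d {i} k)"
  | "t_alg_J F d J k = (\<Sum>k'<k. (t_alg F d k' - t_alg_J F d J k') * F J k' k)"
  by pat_completeness auto
termination
  \<comment> \<open>At equal \<open>k\<close> the only call is from \<open>t_alg\<close> to
    \<open>t_alg_J\<close>, hence the odd, larger weight of \<open>t_alg\<close>; all other calls
    lower \<open>k\<close>.\<close>
  by (relation "Wellfounded.measure (case_sum (\<lambda>(_, _, k). 2 * k + 1) (\<lambda>(_, _, _, k). 2 * k))") auto

declare t_alg.simps [simp del] t_alg_J.simps [simp del]

text \<open>\<open>len\<close> is the cardinality of \<open>D_set C r m_plus\<close>, which may be
  infinite. \<open>F_exists\<close> and \<open>F_span\<close> are the facts about \<open>F_t\<close>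
  that are assumed known.\<close>

locale t_algorithm =
  fixes C :: "'i::{finite,linorder} \<Rightarrow> 'i \<Rightarrow> int" and r :: "'i \<Rightarrow> nat"
    and m_plus :: "'i monom" and m :: "nat \<Rightarrow> 'i monom" and len :: enat
  assumes card_I: "CARD('i) \<ge> 3"
    and F_exists: "\<And>J p. J \<noteq> {} \<Longrightarrow> J \<noteq> UNIV \<Longrightarrow> p \<in> dominant J \<Longrightarrow> \<exists>!x. is_F C r J p x"
    and m_plus_dominant: "m_plus \<in> dominant UNIV"
    and F_span: "\<And>J. J \<noteq> {} \<Longrightarrow> J \<noteq> UNIV \<Longrightarrow>
           K_inf C r J \<inter> D_tilde C r m_plus = F_sums C r J (D_set C r m_plus \<inter> dominant J)"
    and m_bij: "bij_betw m {k. enat k < len} (D_set C r m_plus)"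
    and m_0: "m 0 = m_plus"
    and compatible: "\<And>a b. enat a < len \<Longrightarrow> enat b < len \<Longrightarrow> mon_le C r (m a) (m b) \<Longrightarrow> b \<le> a"
begin

abbreviation coeff :: "'i set \<Rightarrow> nat \<Rightarrow> nat \<Rightarrow> laurent" where
  "coeff J a b \<equiv> F_t C r J (m a) (m b)"

definition defect :: "nat \<Rightarrow> 'i option" where
  "defect k =
     (if m k \<in> dominant UNIV then None else Some (SOME i. m k \<notin> dominant {i}))"

abbreviation s :: "nat \<Rightarrow> laurent" where
  "s \<equiv> t_alg coeff defect"

abbreviation sJ :: "'i set \<Rightarrow> nat \<Rightarrow> laurent" where
  "sJ \<equiv> t_alg_J coeff defect"

lemma insert_proper: "{i, j} \<noteq> (UNIV :: 'i set)"
proof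
  assume "{i, j} = (UNIV :: 'i set)"
  then have "CARD('i) = card {i, j}" by (rule arg_cong[OF sym])
  also have "\<dots> \<le> 2" by (simp add: card_insert_if)
  finally show False using card_I by simp
qed

lemma singleton_proper: "{i} \<noteq> (UNIV :: 'i set)"
  using insert_proper[of i i] by simp

section \<open>Coefficients of the \<open>F_t\<close> along the enumeration\<close>

lemma is_F_F_t:
  assumes "J \<noteq> {}" "J \<noteq> UNIV" "p \<in> dominant J"
  shows "is_F C r J p (F_t C r J p)"
  using theI'[OF F_exists[OF assms]] assms(3) by (simp add: F_t_def)

lemma F_t_diag:
  assumes "J \<noteq> {}" "J \<noteq> UNIV" "p \<in> dominant J"
  shows "F_t C r J p p = 1"
  using is_F_F_t[OF assms] by (simp add: is_F_def)

lemma F_t_outside: "p \<notin> dominant J \<Longrightarrow> F_t C r J p q = 0"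
  by (simp add: F_t_def)

text \<open>The support of \<open>F_t C r J (m a)\<close> lies in \<open>D_set C r (m a)\<close>,
  hence below \<open>m a\<close>, and the enumeration lists smaller monomials later.\<close>

lemma coeff_less:
  assumes "J \<noteq> {}" "J \<noteq> UNIV" "enat a < len" "enat b < len" "b < a"
  shows "coeff J a b = 0"
proof (rule ccontr)
  assume nz: "coeff J a b \<noteq> 0"
  then have "m a \<in> dominant J" using F_t_outside by blast
  with is_F_F_t assms nz have "m b \<in> D_set C r (m a)"
    by (auto simp: is_F_def D_tilde_def)
  then show False
    using compatible[of b a] D_set_mon_le assms by fastforce
qed

text \<open>The sum over \<open>D\<^bsub>m\<^sub>+\<^esub>\<close> is a finite one by triangularity, so that no junk value arises.\<close>

lemma F_sums_nth:
  assumes J: "J \<noteq> {}" "J \<noteq> UNIV" and b: "enat b < len"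
  shows "(\<Sum>q | q \<in> D_set C r m_plus \<inter> dominant J \<and> F_t C r J q (m b) \<noteq> 0.
            lam q * F_t C r J q (m b)) = (\<Sum>a\<le>b. lam (m a) * coeff J a b)"
    (is "sum _ ?S = _")
proof -
  have lt: "enat a < len" if "a \<le> b" for a
    using that b by (meson enat_ord_simps(1) order_le_less_trans)
  have sub: "?S \<subseteq> m ` {..b}"
  proof
    fix q assume q: "q \<in> ?S"
    then obtain a where a: "enat a < len" "q = m a"
      using m_bij by (auto simp: bij_betw_def)
    then have "a \<le> b"
      using q coeff_less[OF J a(1) b] by force
    with a show "q \<in> m ` {..b}" by simp
  qed
  have "inj_on m {..b}"
    using m_bij lt by (auto simp: bij_betw_def intro: inj_on_subset)
  moreover have "sum (\<lambda>q. lam q * F_t C r J q (m b)) ?S =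
      sum (\<lambda>q. lam q * F_t C r J q (m b)) (m ` {..b})"
  proof (rule sum.mono_neutral_left[OF _ sub])
    have "m a \<in> D_set C r m_plus" if "a \<le> b" for a
      using m_bij lt[OF that] by (auto simp: bij_betw_def)
    \<comment> \<open>A monomial left out of \<open>?S\<close> is not \<open>J\<close>-dominant,
      where \<open>F_t\<close> is 0 by convention, or its coefficient at \<open>m b\<close> is
      0.\<close>
    then show "\<forall>q \<in> m ` {..b} - ?S. lam q * F_t C r J q (m b) = 0"
      using F_t_outside by auto
  qed simp
  ultimately show ?thesis
    by (simp add: sum.reindex)
qed

text \<open>As \<open>K_inf C r J\<close> lies in \<open>K_inf C r {i}\<close>, a sum of the
  \<open>F_t\<close> for \<open>J\<close> also satisfies the description \<open>F_span\<close> for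
  \<open>{i}\<close>.\<close>

lemma F_sums_transfer:
  assumes J: "J \<noteq> {}" "J \<noteq> UNIV" and "i \<in> J"
  obtains lam' where "\<And>b. enat b < len \<Longrightarrow>
    (\<Sum>a\<le>b. lam (m a) * coeff J a b) = (\<Sum>a\<le>b. lam' (m a) * coeff {i} a b)"
proof -
  define x where "x = (\<lambda>p. \<Sum>q | q \<in> D_set C r m_plus \<inter> dominant J \<and> F_t C r J q p \<noteq> 0.
            lam q * F_t C r J q p)"
  have "x \<in> F_sums C r J (D_set C r m_plus \<inter> dominant J)"
    unfolding F_sums_def x_def by blast
  then have "x \<in> K_inf C r {i} \<inter> D_tilde C r m_plus"
    using F_span[OF J] K_inf_antimono[of "{i}" J] \<open>i \<in> J\<close> by blast
  then have "x \<in> F_sums C r {i} (D_set C r m_plus \<inter> dominant {i})"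
    using F_span singleton_proper by blast
  then obtain lam' where x_eq:
    "x = (\<lambda>p. \<Sum>q | q \<in> D_set C r m_plus \<inter> dominant {i} \<and> F_t C r {i} q p \<noteq> 0.
            lam' q * F_t C r {i} q p)"
    unfolding F_sums_def by blast
  have "(\<Sum>a\<le>b. lam (m a) * coeff J a b) = (\<Sum>a\<le>b. lam' (m a) * coeff {i} a b)"
    if b: "enat b < len" for b
  proof -
    have "(\<Sum>a\<le>b. lam (m a) * coeff J a b) = x (m b)"
      unfolding x_def by (rule F_sums_nth[OF J b, symmetric])
    also have "\<dots> = (\<Sum>a\<le>b. lam' (m a) * coeff {i} a b)"
      unfolding x_eq by (rule F_sums_nth[OF insert_not_empty singleton_proper b])
    finally show ?thesis .
  qed
  then show ?thesis using that by blast
qed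

section \<open>Consistency of the algorithm\<close>

lemma sJ_rec: "sJ J k = (\<Sum>k'<k. (s k' - sJ J k') * coeff J k' k)"
  by (rule t_alg_J.simps)

lemma s_0: "s 0 = 1"
  by (simp add: t_alg.simps)

lemma sJ_0: "sJ J 0 = 0"
  by (subst sJ_rec) simp

text \<open>The terms \<open>a < b\<close> give \<open>sJ J b\<close> by the recursion. The term
  \<open>a = b\<close> adds the difference \<open>s b - sJ J b\<close>, which is already 0 when
  \<open>m b\<close> is not \<open>J\<close>-dominant.\<close>

lemma s_expansion:
  assumes J: "J \<noteq> {}" "J \<noteq> UNIV"
    and s_eq: "\<And>k. 1 \<le> k \<Longrightarrow> k < n \<Longrightarrow> m k \<notin> dominant J \<Longrightarrow> s k = sJ J k"
    and "b < n"
  shows "(\<Sum>a\<le>b. (s a - sJ J a) * coeff J a b) = s b"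
proof -
  have "(\<Sum>a\<le>b. (s a - sJ J a) * coeff J a b) = sJ J b + (s b - sJ J b) * coeff J b b"
    by (simp add: lessThan_Suc_atMost[symmetric] sJ_rec[of J b, symmetric])
  also have "\<dots> = s b"
  proof (cases "m b \<in> dominant J")
    case True
    then show ?thesis by (simp add: F_t_diag[OF J])
  next
    case False
    \<comment> \<open>\<open>s_eq\<close> starts at 1; index 0 is excluded because
      \<open>m_plus\<close> is dominant.\<close>
    then have "b \<noteq> 0"
      using m_plus_dominant m_0 dominant_antimono[OF subset_UNIV, of J] by (metis subsetD)
    then show ?thesis
      using s_eq[of b] False \<open>b < n\<close> by simp
  qed
  finally show ?thesis .
qed

lemma sJ_singleton:
  assumes J: "J \<noteq> {}" "J \<noteq> UNIV" and "i \<in> J" and n: "enat n < len"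
    and s_eq: "\<And>k I. 1 \<le> k \<Longrightarrow> k < n \<Longrightarrow> I \<noteq> {} \<Longrightarrow> I \<noteq> UNIV \<Longrightarrow> m k \<notin> dominant I \<Longrightarrow> s k = sJ I k"
    and not_dom: "m n \<notin> dominant {i}"
  shows "sJ J n = sJ {i} n"
proof -
  have ndJ: "m n \<notin> dominant J"
    using not_dom dominant_antimono[of "{i}" J] \<open>i \<in> J\<close> by auto
  have lt: "enat a < len" if "a \<le> n" for a
    using that n by (meson enat_ord_simps(1) order_le_less_trans)
  have inj: "inj_on m {k. enat k < len}"
    using m_bij by (simp add: bij_betw_def)
  \<comment> \<open>\<open>F_sums_transfer\<close> takes coefficients indexed by monomials, so
    positions are recovered by inverting the enumeration.\<close>
  define idx where "idx = inv_into {k. enat k < len} m"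
  have idx: "idx (m a) = a" if "a \<le> n" for a
    using inv_into_f_f[OF inj] lt[OF that] by (simp add: idx_def)
  obtain lam' where lam': "\<And>b. enat b < len \<Longrightarrow>
      (\<Sum>a\<le>b. (s (idx (m a)) - sJ J (idx (m a))) * coeff J a b) =
      (\<Sum>a\<le>b. lam' (m a) * coeff {i} a b)"
    using F_sums_transfer[OF J \<open>i \<in> J\<close>, of "\<lambda>p. s (idx p) - sJ J (idx p)"] by blast
  have eq: "(\<Sum>a\<le>b. (s a - sJ J a) * coeff J a b) = (\<Sum>a\<le>b. lam' (m a) * coeff {i} a b)"
    if "b \<le> n" for b
    using lam'[OF lt[OF that]] that idx by (simp cong: sum.cong_simp)
  have last: "(\<Sum>a\<le>n. (s a - sJ I a) * coeff I a n) = sJ I n" if "m n \<notin> dominant I" for I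
    by (simp add: lessThan_Suc_atMost[symmetric] F_t_outside[OF that]
        sJ_rec[of I n, symmetric])
  \<comment> \<open>Both combinations of the \<open>{i}\<close>-rows have coefficient
    \<open>s b\<close> at every \<open>b < n\<close>, so their difference is fed to the vanishing
    lemma.\<close>
  have "(\<Sum>a\<le>n. (lam' (m a) - (s a - sJ {i} a)) * coeff {i} a n) = 0"
  proof (rule unitriangular_vanish[where X = "{a. m a \<in> dominant {i}}"])
    show "coeff {i} a a = 1" if "a \<in> {a. m a \<in> dominant {i}}" for a
      using that by (intro F_t_diag) (simp_all add: singleton_proper)
    show "coeff {i} a b = 0" if "a \<notin> {a. m a \<in> dominant {i}}" for a b
      using that by (simp add: F_t_outside)
    show "n \<notin> {a. m a \<in> dominant {i}}" using not_dom by simp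
    fix b assume b: "b < n"
    have "(\<Sum>a\<le>b. lam' (m a) * coeff {i} a b) = s b"
      using eq[of b] s_expansion[OF J s_eq b] J b by simp
    moreover have "(\<Sum>a\<le>b. (s a - sJ {i} a) * coeff {i} a b) = s b"
      using s_expansion[OF insert_not_empty singleton_proper s_eq b] b singleton_proper by simp
    ultimately show "(\<Sum>a\<le>b. (lam' (m a) - (s a - sJ {i} a)) * coeff {i} a b) = 0"
      by (simp add: left_diff_distrib sum_subtractf)
  qed
  then have "(\<Sum>a\<le>n. lam' (m a) * coeff {i} a n) = (\<Sum>a\<le>n. (s a - sJ {i} a) * coeff {i} a n)"
    by (simp add: left_diff_distrib sum_subtractf)
  then show ?thesis
    using eq[of n] last[OF ndJ] last[OF not_dom] by simp
qed

lemma s_eq_sJ: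
  assumes "1 \<le> n" "enat n < len" "J \<noteq> {}" "J \<noteq> UNIV" "m n \<notin> dominant J"
  shows "s n = sJ J n"
  using assms
proof (induction n arbitrary: J rule: less_induct)
  case (less n)
  have IH: "s k = sJ I k"
    if "1 \<le> k" "k < n" "I \<noteq> {}" "I \<noteq> UNIV" "m k \<notin> dominant I" for k I
    using less.IH[OF that(2,1) _ that(3-5)] less.prems(2) that(2)
    by (meson enat_ord_simps(2) order_less_trans)
  obtain j where j: "j \<in> J" "m n \<notin> dominant {j}"
    using less.prems(5) by (rule not_dominantE)
  \<comment> \<open>The same choice as in \<open>defect\<close>, so \<open>s n\<close> unfolds to
    \<open>sJ {i} n\<close>.\<close>
  define i where "i = (SOME i. m n \<notin> dominant {i})"
  have i: "m n \<notin> dominant {i}"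
    unfolding i_def using j(2) by (rule someI)
  have "m n \<notin> dominant UNIV"
    using i dominant_antimono[of "{i}" UNIV] by auto
  then have "s n = sJ {i} n"
    using less.prems(1) by (simp add: t_alg.simps defect_def i_def)
  \<comment> \<open>The pair, with \<open>i = j\<close> allowed, links the index chosen by
    \<open>defect\<close> to one in \<open>J\<close>; it is proper because there are at least three
    nodes.\<close>
  also have "\<dots> = sJ {i, j} n"
    using sJ_singleton[where J = "{i, j}", OF _ insert_proper _ less.prems(2) IH i] by simp
  also have "\<dots> = sJ {j} n"
    using sJ_singleton[where J = "{i, j}", OF _ insert_proper _ less.prems(2) IH j(2)] by simp
  also have "\<dots> = sJ J n"
    using sJ_singleton[OF less.prems(3,4) j(1) less.prems(2) IH j(2)] by simp
  finally show ?case .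
qed

lemma s_dominant: "1 \<le> n \<Longrightarrow> m n \<in> dominant UNIV \<Longrightarrow> s n = 0"
  by (simp add: t_alg.simps defect_def)

end

theorem lemma5p24:
  fixes C :: "'i::{finite,linorder} \<Rightarrow> 'i \<Rightarrow> int" and r :: "'i \<Rightarrow> nat"
    and m_plus :: "'i monom" and m :: "nat \<Rightarrow> 'i monom" and len :: enat and R :: nat
  assumes "cartan_data C r"
    and "CARD('i) \<ge> 3"
    and F_exists: "\<forall>J p. J \<noteq> {} \<and> J \<noteq> UNIV \<and> p \<in> dominant J \<longrightarrow> (\<exists>!x. is_F C r J p x)"
    and "m_plus \<in> dominant UNIV"
    and F_span: "\<forall>J. J \<noteq> {} \<and> J \<noteq> UNIV \<longrightarrow>
           K_inf C r J \<inter> D_tilde C r m_plus = F_sums C r J (D_set C r m_plus \<inter> dominant J)"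
    and enumeration: "bij_betw m {k. enat k < len} (D_set C r m_plus)" "m 0 = m_plus"
    and compatible: "\<forall>a b. enat a < len \<and> enat b < len \<and> mon_le C r (m a) (m b) \<longrightarrow> b \<le> a"
    and "enat R < len"
  shows "\<exists>(s :: 'i monom \<Rightarrow> laurent) (sJ :: 'i set \<Rightarrow> 'i monom \<Rightarrow> laurent).
    s (m 0) = 1 \<and>
    (\<forall>J. J \<noteq> {} \<and> J \<noteq> UNIV \<longrightarrow> sJ J (m 0) = 0) \<and>
    (\<forall>k. 1 \<le> k \<and> k \<le> R \<longrightarrow>
       (\<forall>J. J \<noteq> {} \<and> J \<noteq> UNIV \<longrightarrow>
          sJ J (m k) = (\<Sum>k'<k. (s (m k') - sJ J (m k')) * F_t C r J (m k') (m k)) \<and>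
          (m k \<notin> dominant J \<longrightarrow> s (m k) = sJ J (m k))) \<and>
       (m k \<in> dominant UNIV \<longrightarrow> s (m k) = 0))"
proof -
  interpret t_algorithm C r m_plus m len
  proof
    show "CARD('i) \<ge> 3" "m_plus \<in> dominant UNIV" "m 0 = m_plus"
      "bij_betw m {k. enat k < len} (D_set C r m_plus)"
      using assms(2,4) enumeration by simp_all
    show "\<exists>!x. is_F C r J p x" if "J \<noteq> {}" "J \<noteq> UNIV" "p \<in> dominant J" for J p
      using that F_exists by simp
    show "K_inf C r J \<inter> D_tilde C r m_plus = F_sums C r J (D_set C r m_plus \<inter> dominant J)"
      if "J \<noteq> {}" "J \<noteq> UNIV" for J
      using that F_span by simp
    show "b \<le> a" if "enat a < len" "enat b < len" "mon_le C r (m a) (m b)" for a b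
      using that compatible by simp
  qed
  \<comment> \<open>The recursion runs over positions, while the witnesses must be functions of
    monomials.\<close>
  define idx where "idx = inv_into {k. enat k < len} m"
  have lt: "enat k < len" if "k \<le> R" for k
    using that \<open>enat R < len\<close> by (meson enat_ord_simps(1) order_le_less_trans)
  then have idx: "idx (m k) = k" if "k \<le> R" for k
    using m_bij that by (simp add: idx_def bij_betw_def inv_into_f_f)
  have recursion: "sJ J k = (\<Sum>k'<k. (s (idx (m k')) - sJ J (idx (m k'))) * coeff J k' k)"
    if "k \<le> R" for J :: "'i set" and k
    using that by (subst sJ_rec) (simp add: idx cong: sum.cong_simp)
  show ?thesis
  proof (rule exI[of _ "\<lambda>p. s (idx p)"], rule exI[of _ "\<lambda>J p. sJ J (idx p)"],
      intro conjI allI impI)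
    fix k and J :: "'i set"
    assume k: "1 \<le> k \<and> k \<le> R" and J: "J \<noteq> {} \<and> J \<noteq> UNIV"
    show "sJ J (idx (m k)) =
        (\<Sum>k'<k. (s (idx (m k')) - sJ J (idx (m k'))) * F_t C r J (m k') (m k))"
      using recursion k idx by simp
    assume "m k \<notin> dominant J"
    then show "s (idx (m k)) = sJ J (idx (m k))"
      using s_eq_sJ k J lt idx by simp
  qed (simp_all add: idx s_0 sJ_0 s_dominant)
qed

end
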